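(* Let $g:\mathbb{N}\to\mathbb{R}$ be a nonnegative function, let $n,d$ be integers with $2\le d\le n-1$, and let $T$ be a tree with order $n$ and diameter $d$. (a) If $g$ is strictly increasing, then $W(T;g)\geq W(\mathbf{T}_{d,n};g)$. Equality holds if and only if $T=\mathbf{T}_{d,n}$. (b) If $g$ is strictly decreasing, then $W(T;g)\leq W(\mathbf{T}_{d,n};g)$. Equality holds if and only if $T=\mathbf{T}_{d,n}$.
   Context: $\mathbb{N}$ is the set of positive integers. For trees, $T_1=T_2$ means that $T_1$ and $T_2$ are isomorphic. For a connected graph $G$ and $g:\mathbb{N}\to\mathbb{R}$, $W(G;g)=\sum_{\{u,v\}\subseteq V(G),\,u\ne v} g(d(u,v))$, the sum over all unordered pairs of distinct vertices, where $d(u,v)$ is the usual distance. For integers $2\le d\le n-1$, $\mathbf{T}_{d,n}$ is the tree obtained by attaching $n-d-1$ pendent edges to a centre vertex of the path of order $d+1$. *)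

theory Defs
  imports "Graph_Theory.Graph_Theory"
begin

text \<open>
  Finite simple graphs are the symmetric loop-free pair digraphs of the locale
  \<^locale>\<open>pair_graph\<close>: every edge \<open>{u, v}\<close> is represented by the two arcs
  \<open>(u, v)\<close> and \<open>(v, u)\<close>.

  The library predicate \<^const>\<open>tree\<close> is unusable for such graphs: it counts the closed walk
  \<open>u, v, u\<close> along a single edge as a cycle. A cycle of the undirected graph is a
  directed cycle with at least three arcs.
\<close>

definition undirected_tree :: "'a pair_pre_digraph \<Rightarrow> bool" where
  "undirected_tree T \<longleftrightarrow>
     pair_graph T \<and>
     Digraph_Component.connected (with_proj T) \<and>
     \<not> (\<exists>p. pre_digraph.cycle (with_proj T) p \<and> 3 \<le> length p)"

definition gdist :: "'a pair_pre_digraph \<Rightarrow> 'a \<Rightarrow> 'a \<Rightarrow> nat" where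
  "gdist G u v = (LEAST k. \<exists>p. pre_digraph.awalk (with_proj G) u p v \<and> length p = k)"

definition gdiameter :: "'a pair_pre_digraph \<Rightarrow> nat" where
  "gdiameter G = Max {gdist G u v | u v. u \<in> pverts G \<and> v \<in> pverts G}"

text \<open>The distance as a function of the unordered pair; see \<open>pair_gdist_doubleton\<close>.\<close>

definition pair_gdist :: "'a pair_pre_digraph \<Rightarrow> 'a set \<Rightarrow> nat" where
  "pair_gdist G e = (THE k. \<exists>u v. e = {u, v} \<and> k = gdist G u v)"

definition wiener :: "'a pair_pre_digraph \<Rightarrow> (nat \<Rightarrow> real) \<Rightarrow> real" where
  "wiener G g =
     (\<Sum>e \<in> {{u, v} | u v. u \<in> pverts G \<and> v \<in> pverts G \<and> u \<noteq> v}. g (pair_gdist G e))"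

text \<open>
  The path has the vertices \<open>0, \<dots>, d\<close>, and \<open>d + 1, \<dots>, n - 1\<close> are the pendent vertices.
  For odd \<open>d\<close> the path has the two centres \<open>d div 2\<close> and \<open>d div 2 + 1\<close>, which are exchanged
  by its reversal, so either choice gives the same tree up to isomorphism.
\<close>

definition centre_star_path :: "nat \<Rightarrow> nat \<Rightarrow> nat pair_pre_digraph" where
  "centre_star_path d n =
     \<lparr> pverts = {..<n},
       parcs = symcl ({(i, i + 1) | i. i < d} \<union> {(d div 2, j) | j. d < j \<and> j < n}) \<rparr>"

lemma pair_graph_centre_star_path:
  assumes "d < n"
  shows "pair_graph (centre_star_path d n)"
proof -
  let ?G = "centre_star_path d n"
  have sub: "parcs ?G \<subseteq> {..<n} \<times> {..<n}"
    using assms by (auto simp: centre_star_path_def symcl_def)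
  have fin: "finite (parcs ?G)"
    using sub by (rule finite_subset) auto
  show ?thesis
  proof
    show "finite (parcs ?G)" by (rule fin)
    show "symmetric (with_proj ?G)"
      by (auto simp: symmetric_def centre_star_path_def symcl_def sym_def)
  qed (use sub in \<open>auto simp: centre_star_path_def symcl_def\<close>)
qed

text \<open>Agreement with the library's weighted distance for unit weights.\<close>

lemma mu_unit_eq_gdist:
  assumes "pair_wf_digraph G" "pre_digraph.awalk (with_proj G) u p v"
  shows "wf_digraph.\<mu> (with_proj G) (\<lambda>_. 1) u v = ereal (real (gdist G u v))"
proof -
  interpret pair_wf_digraph G by fact
  have cost: "awalk_cost (\<lambda>_. 1) q = real (length q)" for q :: "('a \<times> 'a) list"
    by (induct q) auto
  have "\<exists>q. awalk u q v \<and> length q = gdist G u v"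
    unfolding gdist_def by (rule LeastI_ex) (use assms(2) in auto)
  then obtain q where q: "awalk u q v" "length q = gdist G u v" by blast
  have least: "gdist G u v \<le> length r" if "awalk u r v" for r
    unfolding gdist_def by (rule Least_le) (use that in auto)
  show ?thesis
    unfolding \<mu>_def
  proof (rule antisym)
    show "(INF p\<in>{p. awalk u p v}. ereal (awalk_cost (\<lambda>_. 1) p)) \<le> ereal (real (gdist G u v))"
      using q by (intro INF_lower2[of q]) (auto simp: cost)
    show "ereal (real (gdist G u v)) \<le> (INF p\<in>{p. awalk u p v}. ereal (awalk_cost (\<lambda>_. 1) p))"
      using least by (intro INF_greatest) (auto simp: cost)
  qed
qed

lemma gdist_commute:
  assumes "pair_graph G"
  shows "gdist G u v = gdist G v u"
proof -
  interpret pair_graph G by fact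
  have "\<exists>q. awalk y q x \<and> length q = length p" if "awalk x p y" for x y p
    using that
  proof (induct p arbitrary: x)
    case Nil
    then show ?case by (auto simp: awalk_Nil_iff)
  next
    case (Cons e p)
    obtain a b where e: "e = (a, b)" by force
    from Cons.prems e have h: "a = x" "(x, b) \<in> parcs G" "awalk b p y"
      by (auto simp: awalk_Cons_iff)
    from Cons.hyps[OF h(3)] obtain q where q: "awalk y q b" "length q = length p" by blast
    have "(b, x) \<in> parcs G" using h(2) by (rule arcs_symmetric)
    then have "awalk b [(b, x)] x"
      using in_arcsD1 in_arcsD2 by (auto simp: awalk_Cons_iff awalk_Nil_iff)
    with q have "awalk y (q @ [(b, x)]) x" by (auto intro: awalk_appendI)
    then show ?case using q by (intro exI[of _ "q @ [(b, x)]"]) auto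
  qed
  then have "(\<exists>p. awalk u p v \<and> length p = k) \<longleftrightarrow> (\<exists>p. awalk v p u \<and> length p = k)" for k
    by metis
  then show ?thesis by (simp add: gdist_def)
qed

lemma pair_gdist_doubleton:
  assumes "pair_graph G"
  shows "pair_gdist G {u, v} = gdist G u v"
  unfolding pair_gdist_def
  by (rule the_equality) (use gdist_commute[OF assms] in \<open>auto simp: doubleton_eq_iff\<close>)

end

theory Submission
  imports Defs
begin

text \<open>
  Fix a geodesic \<open>v 0, \<dots>, v d\<close> that realises the diameter of \<open>T\<close> and let \<open>g\<close> be strictly
  increasing; the decreasing case follows by passing to \<open>- g\<close>. The pairs of vertices fall into
  three classes.

  Pairs on the geodesic contribute the same in \<open>T\<close> and in the extremal tree.

  A vertex \<open>u\<close> off the geodesic has distances \<open>h + absdiff i j\<close> to its points \<open>v j\<close>, where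
  \<open>v i\<close> is the nearest point and \<open>h \<ge> 1\<close> (\<open>geodesic_profile\<close>). The sum of the corresponding
  values of \<open>g\<close> is least for \<open>h = 1\<close> and \<open>i\<close> a centre, which is what happens in the extremal tree
  (\<open>profile_sum_centre_less\<close>); it exceeds this minimum by more than \<open>g 2 - g 1\<close> as soon as
  \<open>h \<ge> 2\<close> (\<open>profile_sum_height_gain\<close>).

  Two vertices off the geodesic have distance 2 in the extremal tree. In \<open>T\<close> they contribute less
  only if they are adjacent, and then by \<open>g 2 - g 1\<close>. Such an edge is charged to the end that is
  farther from \<open>v 0\<close>. That end is not adjacent to the geodesic, so it has a surplus of more than
  \<open>g 2 - g 1\<close>, and it is charged only once because it has a single neighbour towards \<open>v 0\<close>
  (\<open>card_arcs_off_path\<close>).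

  Adding up gives the inequality (\<open>wiener_tree_bound\<close>). In the case of equality all vertices off
  the geodesic hang at a centre and have mutual distance at most 2, hence all hang at the same one
  (\<open>pendants_at_common_vertex\<close>). This determines all distances, and so the tree up to isomorphism
  (\<open>path_with_pendants_isometry\<close>).

  The structure of trees enters only through \<open>nonfarther_neighbour_unique\<close>: with respect to any
  root a vertex has at most one neighbour that is not farther from the root than itself.
\<close>

section \<open>Distances in connected graphs\<close>

locale connected_pair_graph = pair_graph +
  assumes walk_exists: "u \<in> pverts G \<Longrightarrow> v \<in> pverts G \<Longrightarrow> \<exists>p. awalk u p v"
begin

lemma gdist_le_length: "awalk u p v \<Longrightarrow> gdist G u v \<le> length p"
  unfolding gdist_def by (rule Least_le) auto

lemma obtain_shortest_walk:
  assumes "u \<in> pverts G" "v \<in> pverts G"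
  obtains p where "awalk u p v" "length p = gdist G u v"
proof -
  have "\<exists>p. awalk u p v \<and> length p = gdist G u v"
    unfolding gdist_def by (rule LeastI_ex) (use walk_exists[OF assms] in auto)
  then show thesis using that by blast
qed

lemma dist_commute: "gdist G u v = gdist G v u"
  by (rule gdist_commute) (rule pair_graph_axioms)

lemma gdist_self [simp]:
  assumes "u \<in> pverts G"
  shows "gdist G u u = 0"
  using gdist_le_length[of u "[]" u] assms by (simp add: awalk_Nil_iff)

lemma gdist_eq_0_iff [simp]:
  assumes "u \<in> pverts G" "v \<in> pverts G"
  shows "gdist G u v = 0 \<longleftrightarrow> u = v"
proof
  assume "gdist G u v = 0"
  with obtain_shortest_walk[OF assms] show "u = v"
    by (metis awalk_empty_ends length_0_conv)
qed (use assms in auto)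

lemma gdist_triangle:
  assumes "u \<in> pverts G" "v \<in> pverts G" "w \<in> pverts G"
  shows "gdist G u w \<le> gdist G u v + gdist G v w"
proof -
  obtain p q where "awalk u p v" "length p = gdist G u v" "awalk v q w" "length q = gdist G v w"
    using obtain_shortest_walk assms by metis
  then show ?thesis using gdist_le_length[of u "p @ q" w] awalk_appendI by auto
qed

lemma arc_iff_gdist_1:
  assumes "u \<in> pverts G" "v \<in> pverts G"
  shows "(u, v) \<in> parcs G \<longleftrightarrow> gdist G u v = 1"
proof
  assume a: "(u, v) \<in> parcs G"
  then have "awalk u [(u, v)] v" using assms by (auto simp: awalk_simps)
  then have "gdist G u v \<le> length [(u, v)]" by (rule gdist_le_length)
  then have "gdist G u v \<le> 1" by simp
  moreover have "gdist G u v \<noteq> 0" using a assms no_loops' by auto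
  ultimately show "gdist G u v = 1" by simp
next
  assume "gdist G u v = 1"
  then obtain p where "awalk u p v" "length p = 1"
    using obtain_shortest_walk assms by metis
  then obtain e where "awalk u [e] v" by (auto simp: length_Suc_conv)
  then show "(u, v) \<in> parcs G" by (cases e) (auto simp: awalk_simps)
qed

lemma gdist_arc_le:
  assumes "(u, w) \<in> parcs G" "r \<in> pverts G"
  shows "gdist G u r \<le> Suc (gdist G w r)"
proof -
  have "u \<in> pverts G" "w \<in> pverts G" using assms in_arcsD1 in_arcsD2 by auto
  then show ?thesis using assms gdist_triangle[of u w r] arc_iff_gdist_1[of u w] by simp
qed

lemma obtain_closer_neighbour:
  assumes "u \<in> pverts G" "r \<in> pverts G" "u \<noteq> r"
  obtains w where "(u, w) \<in> parcs G" "gdist G u r = Suc (gdist G w r)"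
proof -
  obtain p where p: "awalk u p r" "length p = gdist G u r"
    using obtain_shortest_walk assms by metis
  with assms obtain e q where pq: "p = e # q" by (cases p) (auto simp: awalk_simps)
  obtain w where e: "e = (u, w)" using p(1) pq by (cases e) (auto simp: awalk_simps)
  have a: "(u, w) \<in> parcs G" "awalk w q r" using p(1) pq e by (auto simp: awalk_simps)
  have "gdist G w r \<le> length q" using a gdist_le_length by blast
  moreover have "gdist G u r \<le> Suc (gdist G w r)" using gdist_arc_le a assms by blast
  ultimately show thesis using that[OF a(1)] p(2) pq by auto
qed

text \<open>
  The points of a shortest walk are indexed by their distance to \<open>y\<close>. Consecutive points being
  adjacent bounds every distance from above, and the triangle inequality through \<open>y\<close> bounds it
  from below.
\<close>

lemma obtain_geodesic:
  assumes "x \<in> pverts G" "y \<in> pverts G"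
  obtains v where "\<And>i. i \<le> gdist G x y \<Longrightarrow> v i \<in> pverts G"
    "\<And>i j. i \<le> gdist G x y \<Longrightarrow> j \<le> gdist G x y \<Longrightarrow> gdist G (v i) (v j) = (i - j) + (j - i)"
proof -
  have "\<exists>v. v (gdist G x y) = x \<and>
      (\<forall>i\<le>gdist G x y. v i \<in> pverts G \<and> gdist G (v i) y = i) \<and>
      (\<forall>i j. i \<le> j \<and> j \<le> gdist G x y \<longrightarrow> gdist G (v j) (v i) \<le> j - i)"
    using assms(1)
  proof (induct "gdist G x y" arbitrary: x)
    case 0
    then have "x = y" using assms by simp
    then show ?case using 0 assms by (intro exI[of _ "\<lambda>_. y"]) auto
  next
    case (Suc k)
    then have "x \<noteq> y" using assms(2) gdist_self by fastforce
    then obtain w where w: "(x, w) \<in> parcs G" "gdist G x y = Suc (gdist G w y)"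
      using obtain_closer_neighbour Suc.prems assms(2) by metis
    have wV: "w \<in> pverts G" and kw: "k = gdist G w y"
      using w Suc.hyps(2) in_arcsD2 by auto
    obtain v where v: "v k = w" "\<And>i. i \<le> k \<Longrightarrow> v i \<in> pverts G \<and> gdist G (v i) y = i"
      "\<And>i j. i \<le> j \<Longrightarrow> j \<le> k \<Longrightarrow> gdist G (v j) (v i) \<le> j - i"
      using Suc.hyps(1)[OF kw wV] kw by auto
    have new: "gdist G x (v i) \<le> Suc k - i" if "i \<le> k" for i
      using gdist_arc_le[OF w(1), of "v i"] v(2)[OF that] v(3)[OF that] v(1) that by fastforce
    show ?case
      using v new Suc.prems Suc.hyps(2)[symmetric]
      by (intro exI[of _ "v(Suc k := x)"]) (auto simp: le_Suc_eq)
  qed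
  then obtain v where v: "\<And>i. i \<le> gdist G x y \<Longrightarrow> v i \<in> pverts G \<and> gdist G (v i) y = i"
      "\<And>i j. i \<le> j \<Longrightarrow> j \<le> gdist G x y \<Longrightarrow> gdist G (v j) (v i) \<le> j - i"
    by blast
  have up: "gdist G (v j) (v i) = j - i" if "i \<le> j" "j \<le> gdist G x y" for i j
    using v(2)[OF that] gdist_triangle[of "v j" "v i" y] v(1)[of i] v(1)[of j] that assms(2) by auto
  have "gdist G (v i) (v j) = (i - j) + (j - i)" if "i \<le> gdist G x y" "j \<le> gdist G x y" for i j
    using up[of i j] up[of j i] dist_commute[of "v i" "v j"] that by (cases "i \<le> j") auto
  with v(1) show thesis using that by blast
qed

end

text \<open>
  This computes distances in an explicitly given graph: a candidate \<open>D\<close> for the distance to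
  \<open>r\<close> is right if it drops by at most one along every arc, so that no walk is shorter, and drops
  by exactly one along some arc, so that descending gives a walk of that length.
\<close>

lemma (in pair_graph) gdist_eqI:
  assumes "D r = 0" "r \<in> pverts G"
    and closer: "\<And>u. u \<in> pverts G \<Longrightarrow> u \<noteq> r \<Longrightarrow> \<exists>w. (u, w) \<in> parcs G \<and> D u = Suc (D w)"
    and arc: "\<And>u w. (u, w) \<in> parcs G \<Longrightarrow> D u \<le> Suc (D w)"
    and "u \<in> pverts G"
  shows "gdist G u r = D u" "\<exists>p. awalk u p r"
proof -
  have ex: "\<exists>p. awalk u p r \<and> length p = D u"
    using assms(5)
  proof (induct "D u" arbitrary: u)
    case 0
    then have "u = r" using closer by force
    with assms 0 show ?case by (auto simp: awalk_simps)
  next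
    case (Suc k)
    then have "u \<noteq> r" using assms(1) by auto
    then obtain w where w: "(u, w) \<in> parcs G" "D u = Suc (D w)" using closer Suc by blast
    then obtain p where "awalk w p r" "length p = D w" using Suc in_arcsD2 by (metis Suc_inject)
    with w show ?case by (intro exI[of _ "(u, w) # p"]) (auto simp: awalk_simps in_arcsD1)
  qed
  then show "\<exists>p. awalk u p r" by blast
  have "D u \<le> length p" if "awalk u p r" for p
    using that
  proof (induct p arbitrary: u)
    case Nil
    then show ?case using assms(1) by (auto simp: awalk_simps)
  next
    case (Cons e p)
    then have "D (snd e) \<le> length p" "(u, snd e) \<in> parcs G" by (cases e; auto simp: awalk_simps)+
    then show ?case using arc[of u "snd e"] by simp
  qed
  then show "gdist G u r = D u"
    unfolding gdist_def using ex by (intro Least_equality) auto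
qed

section \<open>Isometries and isomorphisms\<close>

text \<open>
  An isomorphism of digraphs moves arcs as well as vertices and may change the head and tail
  functions. It maps walks to walks of the same length in both directions, so distances are all that is needed
  to remember of it; conversely, arcs are the pairs at distance 1.
\<close>

lemma digraph_iso_imp_isometry:
  assumes "pair_wf_digraph G" "digraph_iso (with_proj G) (with_proj H)"
  shows "\<exists>\<phi>. bij_betw \<phi> (pverts G) (pverts H) \<and>
    (\<forall>u\<in>pverts G. \<forall>v\<in>pverts G. gdist H (\<phi> u) (\<phi> v) = gdist G u v)"
proof -
  interpret pair_wf_digraph G by fact
  obtain f where f: "digraph_isomorphism f" and H: "with_proj H = app_iso f (with_proj G)"
    using assms(2) unfolding digraph_iso_def by blast
  have V: "pverts H = iso_verts f ` pverts G" using H by (metis verts_app_iso with_proj_simps(1))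
  have inj: "inj_on (iso_verts f) (pverts G)"
    using digraph_isomorphism_inj_on_verts[OF f] by simp
  have "(\<exists>p. pre_digraph.awalk (with_proj H) (iso_verts f u) p (iso_verts f v) \<and> length p = k)
      \<longleftrightarrow> (\<exists>p. awalk u p v \<and> length p = k)" if "u \<in> pverts G" "v \<in> pverts G" for u v k
    using awalk_app_isoI[of u _ v f] awalk_app_isoD[of f "iso_verts f u" _ "iso_verts f v"]
      iso_verts_inv_iso[OF f] f that unfolding H by (metis length_map with_proj_simps(1))
  then have "gdist H (iso_verts f u) (iso_verts f v) = gdist G u v"
    if "u \<in> pverts G" "v \<in> pverts G" for u v
    using that by (simp add: gdist_def)
  then show ?thesis using inj V by (intro exI[of _ "iso_verts f"]) (auto simp: bij_betw_def)
qed

lemma isometry_imp_digraph_iso: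
  assumes "connected_pair_graph G" "connected_pair_graph H"
    and bij: "bij_betw \<phi> (pverts G) (pverts H)"
    and isom: "\<And>u v. u \<in> pverts G \<Longrightarrow> v \<in> pverts G \<Longrightarrow> gdist H (\<phi> u) (\<phi> v) = gdist G u v"
  shows "digraph_iso (with_proj G) (with_proj H)"
proof -
  interpret G: connected_pair_graph G by fact
  interpret H: connected_pair_graph H by fact
  have V: "pverts H = \<phi> ` pverts G" and inj: "inj_on \<phi> (pverts G)"
    using bij by (auto simp: bij_betw_def)
  have sub: "parcs G \<subseteq> pverts G \<times> pverts G" using G.in_arcsD1 G.in_arcsD2 by auto
  have A: "parcs H = map_prod \<phi> \<phi> ` parcs G"
  proof (rule set_eqI)
    fix e :: "'b \<times> 'b"
    obtain a b where e: "e = (a, b)" by force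
    show "e \<in> parcs H \<longleftrightarrow> e \<in> map_prod \<phi> \<phi> ` parcs G"
    proof
      assume l: "e \<in> parcs H"
      then have "a \<in> pverts H" "b \<in> pverts H" using e H.in_arcsD1 H.in_arcsD2 by auto
      then obtain x y where xy: "x \<in> pverts G" "y \<in> pverts G" "a = \<phi> x" "b = \<phi> y" using V by auto
      then have "(x, y) \<in> parcs G"
        using l e isom H.arc_iff_gdist_1[of a b] G.arc_iff_gdist_1[of x y] V by auto
      then show "e \<in> map_prod \<phi> \<phi> ` parcs G" using xy e by force
    next
      assume "e \<in> map_prod \<phi> \<phi> ` parcs G"
      then obtain x y where xy: "(x, y) \<in> parcs G" "a = \<phi> x" "b = \<phi> y" using e by auto
      then have "x \<in> pverts G" "y \<in> pverts G" using sub by auto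
      then show "e \<in> parcs H"
        using xy e isom H.arc_iff_gdist_1[of a b] G.arc_iff_gdist_1[of x y] V by auto
    qed
  qed
  have "inj_on (map_prod \<phi> \<phi>) (parcs G)"
    using map_prod_inj_on[OF inj inj] sub inj_on_subset by blast
  then have "G.digraph_isomorphism
      \<lparr>iso_verts = \<phi>, iso_arcs = map_prod \<phi> \<phi>, iso_head = snd, iso_tail = fst\<rparr>"
    using inj G.wf_digraph_axioms by (simp add: G.digraph_isomorphism_def)
  moreover have "with_proj H = app_iso
      \<lparr>iso_verts = \<phi>, iso_arcs = map_prod \<phi> \<phi>, iso_head = snd, iso_tail = fst\<rparr> (with_proj G)"
    using V A by (simp add: app_iso_def with_proj_def)
  ultimately show ?thesis
    unfolding digraph_iso_def by blast
qed

section \<open>Unique parents in trees\<close>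

locale undirected_tree_graph = connected_pair_graph +
  assumes no_long_cycle: "cycle p \<Longrightarrow> length p < 3"
begin

lemma gdist_awalk_verts_less:
  assumes "awalk w p r" "u \<in> set (awalk_verts w p)" "u \<noteq> w"
  shows "gdist G u r < length p"
proof -
  obtain q s where p: "p = q @ s" and q: "awalk w q u" and s: "awalk u s r"
    using awalk_decomp[OF assms(1,2)] by blast
  have "q \<noteq> []" using assms(3) q by (auto simp: awalk_simps)
  then have "length s < length p" using p by simp
  with gdist_le_length[OF s] show ?thesis by simp
qed

text \<open>
  This is the only place where acyclicity enters. Shortest walks from two distinct such neighbours
  to the root miss \<open>u\<close>, because \<open>u\<close> is at least as far from the root as their starting points.
  Joined at the root and shortened to a path they connect the two neighbours without \<open>u\<close>, and
  \<open>u\<close> closes the path to a cycle.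
\<close>

lemma nonfarther_neighbour_unique:
  assumes r: "r \<in> pverts G" and arcs: "(u, w) \<in> parcs G" "(u, w') \<in> parcs G"
    and le: "gdist G w r \<le> gdist G u r" "gdist G w' r \<le> gdist G u r"
  shows "w = w'"
proof (rule ccontr)
  assume ne: "w \<noteq> w'"
  have V: "w \<in> pverts G" "w' \<in> pverts G" "u \<in> pverts G" using arcs in_arcsD1 in_arcsD2 by blast+
  have uw: "u \<noteq> w" "u \<noteq> w'" using arcs no_loops' by blast+
  obtain p where p: "awalk w p r" "length p = gdist G w r"
    using obtain_shortest_walk V r by metis
  obtain p' where p': "awalk w' p' r" "length p' = gdist G w' r"
    using obtain_shortest_walk V r by metis
  have notin: "u \<notin> set (awalk_verts w p)" "u \<notin> set (awalk_verts w' p')"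
    using gdist_awalk_verts_less[OF p(1), of u] gdist_awalk_verts_less[OF p'(1), of u] p p' le uw
    by auto
  define q where "q = p @ rev_path p'"
  have rp: "awalk r (rev_path p') w'" using p' by simp
  then have q: "awalk w q w'" using p by (auto simp: q_def)
  have nq: "u \<notin> set (awalk_verts w q)"
    unfolding q_def using set_awalk_verts_append[OF p(1) rp] notin awalk_verts_rev_path[OF p'(1)]
    by auto
  define c where "c = awalk_to_apath q"
  have c: "apath w c w'" using q apath_awalk_to_apath c_def by blast
  have cw: "awalk w c w'" using c awalkI_apath by blast
  have "set (awalk_verts w c) \<subseteq> set (awalk_verts w q)"
    using awalk_to_apath_subset[OF q] set_awalk_verts[OF q] set_awalk_verts[OF cw]
    unfolding c_def by auto
  then have uc: "u \<notin> set (awalk_verts w c)" using nq by blast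
  have c0: "c \<noteq> []" using cw ne by (auto simp: awalk_simps)
  have last_arc: "awalk w' [(w', u)] u" using arcs arcs_symmetric V by (auto simp: awalk_simps)
  have cb: "awalk w (c @ [(w', u)]) u" using cw last_arc by auto
  then have cl: "awalk u ((u, w) # c @ [(w', u)]) u" using arcs V by (auto simp: awalk_simps)
  have "awalk_verts w (c @ [(w', u)]) = awalk_verts w c @ [u]"
    using awalk_verts_append[OF cb] cw by auto
  then have "distinct (tl (awalk_verts u ((u, w) # c @ [(w', u)])))"
    using c uc by (simp add: apath_def)
  then have cyc: "cycle ((u, w) # c @ [(w', u)])"
    unfolding cycle_def using cl by blast
  have "0 < length c" using c0 by simp
  with no_long_cycle[OF cyc] show False by simp
qed

text \<open>
  An arc between two vertices at the same distance would give one of them a second neighbour that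
  is not farther from the root, besides the next vertex on its way to the root.
\<close>

lemma gdist_arc_cases:
  assumes r: "r \<in> pverts G" and a: "(u, w) \<in> parcs G"
  shows "gdist G u r = Suc (gdist G w r) \<or> gdist G w r = Suc (gdist G u r)"
proof -
  have V: "u \<in> pverts G" "w \<in> pverts G" using a in_arcsD1 in_arcsD2 by blast+
  have "gdist G u r \<noteq> gdist G w r"
  proof
    assume eq: "gdist G u r = gdist G w r"
    have "u \<noteq> r" using V r eq no_loops'[OF a] by auto
    then obtain x where x: "(u, x) \<in> parcs G" "gdist G u r = Suc (gdist G x r)"
      using obtain_closer_neighbour V r by metis
    then have "w = x" using nonfarther_neighbour_unique[OF r a x(1)] eq by simp
    then show False using x eq by simp
  qed
  then show ?thesis
    using gdist_arc_le[OF a r] gdist_arc_le[OF arcs_symmetric[OF a] r] by linarith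
qed

text \<open>
  A walk that turned back towards the root would do so at a vertex whose predecessor and successor
  are both closer to the root; these coincide, so the walk would backtrack.
\<close>

lemma gdist_grows_along_walk:
  assumes r: "r \<in> pverts G"
    and arc: "\<And>k. k < m \<Longrightarrow> (x k, x (Suc k)) \<in> parcs G"
    and nobt: "\<And>k. Suc k < m \<Longrightarrow> x (Suc (Suc k)) \<noteq> x k"
    and start: "0 < m \<Longrightarrow> gdist G (x 0) r \<le> gdist G (x 1) r"
  shows "k \<le> m \<Longrightarrow> gdist G (x k) r = gdist G (x 0) r + k"
proof (induct k rule: less_induct)
  case (less k)
  show ?case
  proof (cases k)
    case (Suc l)
    have lm: "l < m" using less(2) Suc by simp
    have IH: "gdist G (x l) r = gdist G (x 0) r + l" using less(1)[of l] lm Suc by simp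
    have "gdist G (x l) r \<le> gdist G (x k) r"
    proof (cases l)
      case 0
      then show ?thesis using start lm Suc by simp
    next
      case (Suc l')
      have k: "k = Suc (Suc l')" using Suc \<open>k = Suc l\<close> by simp
      have low: "gdist G (x l') r \<le> gdist G (x l) r" using less(1)[of l'] IH k lm Suc by simp
      have a: "(x l, x l') \<in> parcs G" using arc[of l'] arcs_symmetric Suc lm by auto
      show ?thesis
      proof (rule ccontr)
        assume "\<not> ?thesis"
        then have "x k = x l'"
          using nonfarther_neighbour_unique[OF r _ a _ low, of "x k"] arc[OF lm] \<open>k = Suc l\<close> by auto
        then show False using nobt[of l'] k lm Suc by auto
      qed
    qed
    then show ?thesis using gdist_arc_cases[OF r arc[OF lm]] IH Suc by auto
  qed simp
qed

end

lemma undirected_tree_graphI: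
  assumes "undirected_tree T"
  shows "undirected_tree_graph T"
proof -
  interpret pair_graph T using assms by (simp add: undirected_tree_def)
  have "strongly_connected (with_proj T)"
    using symmetric_connected_imp_strongly_connected[OF pair_sym_arcs] assms
    by (simp add: undirected_tree_def)
  then show ?thesis
    using assms
    by unfold_locales (auto simp: strongly_connected_def reachable_awalk undirected_tree_def not_le)
qed

section \<open>Sums along a geodesic\<close>

abbreviation absdiff :: "nat \<Rightarrow> nat \<Rightarrow> nat" where
  "absdiff i j \<equiv> (i - j) + (j - i)"

definition geodesic :: "'a pair_pre_digraph \<Rightarrow> (nat \<Rightarrow> 'a) \<Rightarrow> nat \<Rightarrow> bool" where
  "geodesic G v d \<longleftrightarrow> (\<forall>i\<le>d. v i \<in> pverts G) \<and>
     (\<forall>i\<le>d. \<forall>j\<le>d. gdist G (v i) (v j) = absdiff i j)"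

abbreviation off_path :: "'a pair_pre_digraph \<Rightarrow> (nat \<Rightarrow> 'a) \<Rightarrow> nat \<Rightarrow> 'a set" where
  "off_path G v d \<equiv> pverts G - v ` {..d}"

text \<open>
  The extremal tree, described by its distances only: all vertices outside the geodesic hang at
  \<open>v c\<close>. Two such graphs with the same parameters and the same order are isometric.
\<close>

definition path_with_pendants :: "'a pair_pre_digraph \<Rightarrow> (nat \<Rightarrow> 'a) \<Rightarrow> nat \<Rightarrow> nat \<Rightarrow> bool" where
  "path_with_pendants G v d c \<longleftrightarrow> geodesic G v d \<and>
     (\<forall>u\<in>off_path G v d. \<forall>j\<le>d. gdist G (v j) u = Suc (absdiff c j)) \<and>
     (\<forall>u\<in>off_path G v d. \<forall>w\<in>off_path G v d. u \<noteq> w \<longrightarrow> gdist G u w = 2)"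

text \<open>
  In a tree the distances from a vertex to the points \<open>v 0, \<dots>, v d\<close> of a geodesic have
  the form \<open>h + absdiff i j\<close>: first go to the nearest point \<open>v i\<close>, at distance \<open>h\<close>, then
  along the geodesic. This is the contribution of such a vertex.
\<close>

definition profile_sum :: "(nat \<Rightarrow> real) \<Rightarrow> nat \<Rightarrow> nat \<Rightarrow> nat \<Rightarrow> real" where
  "profile_sum g d h i = (\<Sum>j\<le>d. g (h + absdiff i j))"

lemma geodesic_inj:
  assumes "geodesic G v d"
  shows "inj_on v {..d}"
proof (rule inj_onI)
  fix i j assume ij: "i \<in> {..d}" "j \<in> {..d}" "v i = v j"
  then have "absdiff i j = absdiff i i" using assms unfolding geodesic_def by (metis atMost_iff)
  then show "i = j" by simp
qed

lemma card_off_path: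
  assumes "geodesic G v d" "finite (pverts G)"
  shows "card (off_path G v d) = card (pverts G) - Suc d"
proof -
  have "v ` {..d} \<subseteq> pverts G" using assms(1) by (auto simp: geodesic_def)
  then show ?thesis
    using card_Diff_subset[of "v ` {..d}" "pverts G"] card_image[OF geodesic_inj[OF assms(1)]] by simp
qed

text \<open>
  The two arms of the geodesic at \<open>i\<close> have lengths \<open>i\<close> and \<open>d - i\<close>; both count the value at \<open>i\<close>
  itself. In this form moving \<open>i\<close> by one exchanges a single value of \<open>g\<close>.
\<close>

lemma profile_sum_split:
  assumes "i \<le> d"
  shows "profile_sum g d h i = (\<Sum>t\<le>i. g (h + t)) + (\<Sum>t\<le>d - i. g (h + t)) - g h"
proof -
  have "{..d} = {..i} \<union> {Suc i..d}" using assms by auto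
  then have "profile_sum g d h i =
      (\<Sum>j\<le>i. g (h + absdiff i j)) + (\<Sum>j\<in>{Suc i..d}. g (h + absdiff i j))"
    unfolding profile_sum_def by (subst sum.union_disjoint[symmetric]) auto
  also have "(\<Sum>j\<le>i. g (h + absdiff i j)) = (\<Sum>t\<le>i. g (h + t))"
    by (rule sum.reindex_bij_witness[of _ "\<lambda>t. i - t" "\<lambda>t. i - t"]) auto
  also have "(\<Sum>j\<in>{Suc i..d}. g (h + absdiff i j)) = (\<Sum>t\<in>{Suc 0..d - i}. g (h + t))"
    by (rule sum.reindex_bij_witness[of _ "\<lambda>t. t + i" "\<lambda>t. t - i"]) auto
  also have "{Suc 0..d - i} = {..d - i} - {0}" by auto
  also have "(\<Sum>t\<in>{..d - i} - {0}. g (h + t)) = (\<Sum>t\<le>d - i. g (h + t)) - g h"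
    by (subst sum_diff1) auto
  finally show ?thesis by simp
qed

lemma profile_sum_reflect: "i \<le> d \<Longrightarrow> profile_sum g d h (d - i) = profile_sum g d h i"
  by (simp add: profile_sum_split)

lemma profile_sum_step:
  assumes "strict_mono_on {0<..} g" "0 < h" "Suc i \<le> d div 2"
  shows "profile_sum g d h (Suc i) < profile_sum g d h i"
proof -
  have "d - i = Suc (d - Suc i)" using assms(3) by simp
  then have "(\<Sum>t\<le>d - i. g (h + t)) = (\<Sum>t\<le>d - Suc i. g (h + t)) + g (h + (d - i))"
    by (simp only: sum.atMost_Suc)
  then have "profile_sum g d h i - profile_sum g d h (Suc i) = g (h + (d - i)) - g (h + Suc i)"
    using assms(3) by (simp add: profile_sum_split)
  moreover have "g (h + Suc i) < g (h + (d - i))"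
    using assms by (intro strict_mono_onD[OF assms(1)]) auto
  ultimately show ?thesis by linarith
qed

lemma profile_sum_left_of_centre:
  assumes "strict_mono_on {0<..} g" "0 < h" "i < d div 2"
  shows "profile_sum g d h (d div 2) < profile_sum g d h i"
  using assms(3)
proof (induct "d div 2 - i" arbitrary: i)
  case (Suc k)
  have s: "profile_sum g d h (Suc i) < profile_sum g d h i"
    using profile_sum_step assms(1,2) Suc(3) by simp
  show ?case
  proof (cases "Suc i = d div 2")
    case False
    then have "profile_sum g d h (d div 2) < profile_sum g d h (Suc i)" using Suc by simp
    with s show ?thesis by simp
  qed (use s in simp)
qed simp

text \<open>
  Moving towards the centre replaces the end of the longer arm by a shorter distance. The two
  excluded positions are the centres, which coincide for even \<open>d\<close>.
\<close>

lemma profile_sum_centre_less: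
  assumes "strict_mono_on {0<..} g" "0 < h" "i \<le> d" "i \<noteq> d div 2" "i \<noteq> d - d div 2"
  shows "profile_sum g d h (d div 2) < profile_sum g d h i"
proof (cases "i < d div 2")
  case False
  then have "profile_sum g d h (d div 2) < profile_sum g d h (d - i)"
    using assms by (intro profile_sum_left_of_centre) auto
  then show ?thesis using profile_sum_reflect assms(3) by simp
qed (use profile_sum_left_of_centre assms in blast)

lemma profile_sum_centre_le:
  assumes "strict_mono_on {0<..} g" "0 < h" "i \<le> d"
  shows "profile_sum g d h (d div 2) \<le> profile_sum g d h i"
  using profile_sum_centre_less[OF assms] profile_sum_reflect[of "d div 2" d g h]
  by (cases "i = d div 2"; cases "i = d - d div 2") auto

text \<open>
  The excess \<open>g 2 - g 1\<close> already arises at the centre of the geodesic. The remaining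
  points of the geodesic make the inequality strict, which is what excludes vertices at height at
  least 2 in the case of equality.
\<close>

lemma profile_sum_height_gain:
  assumes "strict_mono_on {0<..} g" "1 \<le> d" "2 \<le> h" "i \<le> d"
  shows "profile_sum g d 1 (d div 2) + (g 2 - g 1) < profile_sum g d h i"
proof -
  let ?c = "d div 2"
  let ?\<delta> = "\<lambda>j. g (2 + absdiff ?c j) - g (1 + absdiff ?c j)"
  have mono: "g x \<le> g y" if "0 < x" "x \<le> y" for x y
    using strict_mono_onD[OF assms(1), of x y] that by (cases "x = y") auto
  have pos: "0 < ?\<delta> j" for j
    using strict_mono_onD[OF assms(1), of "1 + absdiff ?c j" "2 + absdiff ?c j"] by simp
  have "profile_sum g d 2 ?c - profile_sum g d 1 ?c = (\<Sum>j\<le>d. ?\<delta> j)"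
    by (simp add: profile_sum_def sum_subtractf)
  also have "(\<Sum>j\<le>d. ?\<delta> j) = ?\<delta> ?c + (\<Sum>j\<in>{..d} - {?c}. ?\<delta> j)"
    by (rule sum.remove) auto
  finally have eq: "profile_sum g d 2 ?c - profile_sum g d 1 ?c =
      g 2 - g 1 + (\<Sum>j\<in>{..d} - {?c}. ?\<delta> j)" by simp
  have "(\<Sum>j\<in>{..d} - {?c}. ?\<delta> j) > 0"
  proof (rule sum_pos)
    have "d \<in> {..d} - {?c}" using assms(2) by auto
    then show "{..d} - {?c} \<noteq> {}" by blast
  qed (use pos in auto)
  with eq have "profile_sum g d 1 ?c + (g 2 - g 1) < profile_sum g d 2 ?c" by linarith
  also have "\<dots> \<le> profile_sum g d 2 i"
    by (rule profile_sum_centre_le[OF assms(1) _ assms(4)]) simp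
  also have "\<dots> \<le> profile_sum g d h i"
    unfolding profile_sum_def using assms(3) by (intro sum_mono mono) auto
  finally show ?thesis .
qed

section \<open>Decomposition of the Wiener index\<close>

context pair_graph
begin

text \<open>
  Sums over ordered pairs split along a partition of the vertex set without any care for the
  unordered pairs between its parts.
\<close>

lemma wiener_twice:
  "2 * wiener G g =
     (\<Sum>x\<in>pverts G. \<Sum>y\<in>pverts G. if x = y then 0 else g (gdist G x y))"
proof -
  let ?S = "{(x, y). x \<in> pverts G \<and> y \<in> pverts G \<and> x \<noteq> y}"
  let ?E = "{{u, v} | u v. u \<in> pverts G \<and> v \<in> pverts G \<and> u \<noteq> v}"
  let ?f = "\<lambda>(x, y). {x, y}"
  have fin: "finite ?S"
    by (rule finite_subset[of _ "pverts G \<times> pverts G"]) (auto simp: pair_finite_verts)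
  have E: "?E = ?f ` ?S" by auto
  have fibre: "(\<Sum>p\<in>{p \<in> ?S. ?f p = e}. g (gdist G (fst p) (snd p))) = 2 * g (pair_gdist G e)"
    if "e \<in> ?E" for e
  proof -
    obtain u v where e: "e = {u, v}" "u \<in> pverts G" "v \<in> pverts G" "u \<noteq> v" using \<open>e \<in> ?E\<close> by blast
    then have "{p \<in> ?S. ?f p = e} = {(u, v), (v, u)}" by (auto simp: doubleton_eq_iff)
    then show ?thesis
      using e pair_gdist_doubleton[OF pair_graph_axioms, of u v] gdist_commute[OF pair_graph_axioms, of v u]
      by simp
  qed
  have "2 * wiener G g = (\<Sum>e\<in>?E. 2 * g (pair_gdist G e))"
    by (simp add: wiener_def sum_distrib_left)
  also have "\<dots> = (\<Sum>e\<in>?E. \<Sum>p\<in>{p \<in> ?S. ?f p = e}. g (gdist G (fst p) (snd p)))"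
    using fibre by (intro sum.cong) auto
  also have "\<dots> = (\<Sum>p\<in>?S. g (gdist G (fst p) (snd p)))"
    unfolding E using fin by (rule sum.image_gen[symmetric])
  also have "\<dots> = (\<Sum>p\<in>pverts G \<times> pverts G. if fst p = snd p then 0 else g (gdist G (fst p) (snd p)))"
    by (rule sum.mono_neutral_cong_left) (auto simp: pair_finite_verts)
  also have "\<dots> = (\<Sum>x\<in>pverts G. \<Sum>y\<in>pverts G. if x = y then 0 else g (gdist G x y))"
    by (simp add: sum.cartesian_product split_def)
  finally show ?thesis .
qed

lemma wiener_along_geodesic:
  assumes geo: "geodesic G v d"
  shows "2 * wiener G g =
    (\<Sum>i\<le>d. \<Sum>j\<le>d. if i = j then 0 else g (absdiff i j)) +
    2 * (\<Sum>u\<in>off_path G v d. \<Sum>j\<le>d. g (gdist G (v j) u)) +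
    (\<Sum>u\<in>off_path G v d. \<Sum>w\<in>off_path G v d. if u = w then 0 else g (gdist G u w))"
proof -
  let ?H = "\<lambda>x y. if x = y then 0 else g (gdist G x y)"
  let ?P = "v ` {..d}" and ?Q = "off_path G v d"
  have PV: "?P \<subseteq> pverts G" using geo by (auto simp: geodesic_def)
  note inj = geodesic_inj[OF geo]
  have split: "(\<Sum>x\<in>pverts G. f x) = (\<Sum>x\<in>?P. f x) + (\<Sum>x\<in>?Q. f x)" for f :: "'a \<Rightarrow> real"
    using sum.subset_diff[OF PV pair_finite_verts, of f] by simp
  have PP: "(\<Sum>x\<in>?P. \<Sum>y\<in>?P. ?H x y) = (\<Sum>i\<le>d. \<Sum>j\<le>d. if i = j then 0 else g (absdiff i j))"
    using geo inj by (auto simp: sum.reindex[OF inj] geodesic_def inj_on_eq_iff intro!: sum.cong)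
  have row: "(\<Sum>x\<in>?P. ?H x u) = (\<Sum>j\<le>d. g (gdist G (v j) u))" if "u \<in> ?Q" for u
    using that by (auto simp: sum.reindex[OF inj] intro!: sum.cong)
  have QP: "(\<Sum>u\<in>?Q. \<Sum>x\<in>?P. ?H u x) = (\<Sum>u\<in>?Q. \<Sum>j\<le>d. g (gdist G (v j) u))"
  proof (rule sum.cong)
    fix u assume u: "u \<in> ?Q"
    have "(\<Sum>x\<in>?P. ?H u x) = (\<Sum>x\<in>?P. ?H x u)"
      using gdist_commute[OF pair_graph_axioms, of u] by (intro sum.cong) auto
    with row[OF u] show "(\<Sum>x\<in>?P. ?H u x) = (\<Sum>j\<le>d. g (gdist G (v j) u))" by simp
  qed simp
  have PQ: "(\<Sum>x\<in>?P. \<Sum>u\<in>?Q. ?H x u) = (\<Sum>u\<in>?Q. \<Sum>j\<le>d. g (gdist G (v j) u))"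
    by (subst sum.swap) (use row in \<open>auto intro: sum.cong\<close>)
  have "2 * wiener G g = (\<Sum>x\<in>?P. \<Sum>y\<in>?P. ?H x y) + (\<Sum>x\<in>?P. \<Sum>y\<in>?Q. ?H x y) +
      ((\<Sum>x\<in>?Q. \<Sum>y\<in>?P. ?H x y) + (\<Sum>x\<in>?Q. \<Sum>y\<in>?Q. ?H x y))"
    unfolding wiener_twice split sum.distrib by linarith
  then show ?thesis unfolding PP PQ QP by simp
qed

end

lemma sum_off_diagonal:
  fixes a :: real
  assumes "finite Q"
  shows "(\<Sum>u\<in>Q. \<Sum>w\<in>Q. if u = w then 0 else a) = real (card Q) * (real (card Q) - 1) * a"
proof -
  have "(\<Sum>w\<in>Q. if u = w then 0 else a) = (real (card Q) - 1) * a" if "u \<in> Q" for u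
  proof -
    have "(\<Sum>w\<in>Q. if u = w then 0 else a) = (\<Sum>w\<in>Q. a - (if u = w then a else 0))"
      by (intro sum.cong) auto
    then show ?thesis using that assms by (simp add: sum_subtractf algebra_simps)
  qed
  then show ?thesis by simp
qed

text \<open>
  The pairs on the path, the pairs with one vertex on it and the pairs off it, each counted twice,
  for a path with \<open>m\<close> further vertices hanging at its centre.
\<close>

definition pendant_path_value :: "(nat \<Rightarrow> real) \<Rightarrow> nat \<Rightarrow> nat \<Rightarrow> real" where
  "pendant_path_value g d m =
     (\<Sum>i\<le>d. \<Sum>j\<le>d. if i = j then 0 else g (absdiff i j)) +
     2 * (real m * profile_sum g d 1 (d div 2)) + real m * (real m - 1) * g 2"

lemma (in pair_graph) wiener_path_with_pendants:
  assumes "path_with_pendants G v d (d div 2)"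
  shows "2 * wiener G g = pendant_path_value g d (card (off_path G v d))"
proof -
  let ?Q = "off_path G v d"
  have geo: "geodesic G v d" using assms by (simp add: path_with_pendants_def)
  have "(\<Sum>u\<in>?Q. \<Sum>j\<le>d. g (gdist G (v j) u)) = (\<Sum>u\<in>?Q. profile_sum g d 1 (d div 2))"
    using assms by (auto simp: path_with_pendants_def profile_sum_def intro!: sum.cong)
  moreover have "(\<Sum>u\<in>?Q. \<Sum>w\<in>?Q. if u = w then 0 else g (gdist G u w))
      = (\<Sum>u\<in>?Q. \<Sum>w\<in>?Q. if u = w then 0 else g 2)"
    using assms by (intro sum.cong refl) (auto simp: path_with_pendants_def)
  ultimately show ?thesis
    by (simp add: wiener_along_geodesic[OF geo] pendant_path_value_def sum_off_diagonal
        pair_finite_verts)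
qed

lemma wiener_isometry:
  assumes "pair_graph G" "pair_graph H" "bij_betw \<phi> (pverts G) (pverts H)"
    and "\<forall>x\<in>pverts G. \<forall>y\<in>pverts G. gdist H (\<phi> x) (\<phi> y) = gdist G x y"
  shows "wiener H g = wiener G g"
proof -
  have inj: "inj_on \<phi> (pverts G)" and V: "pverts H = \<phi> ` pverts G"
    using assms(3) by (auto simp: bij_betw_def)
  have "2 * wiener H g = 2 * wiener G g"
    unfolding pair_graph.wiener_twice[OF assms(1)] pair_graph.wiener_twice[OF assms(2)] V
    using assms(4) inj by (auto simp: sum.reindex[OF inj] inj_on_eq_iff intro!: sum.cong)
  then show ?thesis by simp
qed

lemma path_with_pendants_isometry:
  assumes G: "path_with_pendants G v d c" "pair_graph G"
    and H: "path_with_pendants H v' d c" "pair_graph H"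
    and card: "card (pverts G) = card (pverts H)"
  shows "\<exists>\<phi>. bij_betw \<phi> (pverts G) (pverts H) \<and>
    (\<forall>x\<in>pverts G. \<forall>y\<in>pverts G. gdist H (\<phi> x) (\<phi> y) = gdist G x y)"
proof -
  let ?Q = "off_path G v d" and ?Q' = "off_path H v' d"
  interpret G: pair_graph G by fact
  interpret H: pair_graph H by fact
  have geo: "geodesic G v d" "geodesic H v' d" using G H by (auto simp: path_with_pendants_def)
  note inj = geodesic_inj[OF geo(1)] geodesic_inj[OF geo(2)]
  have P: "v ` {..d} \<subseteq> pverts G" "v' ` {..d} \<subseteq> pverts H" using geo by (auto simp: geodesic_def)
  have "card ?Q = card ?Q'"
    using card_off_path geo card G.pair_finite_verts H.pair_finite_verts by metis
  then obtain \<psi> where \<psi>: "bij_betw \<psi> ?Q ?Q'"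
    using finite_same_card_bij[of ?Q ?Q'] G.pair_finite_verts H.pair_finite_verts by auto
  define \<phi> where "\<phi> x = (if x \<in> v ` {..d} then v' (the_inv_into {..d} v x) else \<psi> x)" for x
  have \<phi>v: "\<phi> (v i) = v' i" if "i \<le> d" for i
    using that inj(1) by (simp add: \<phi>_def the_inv_into_f_f)
  have \<phi>Q: "\<phi> x = \<psi> x" if "x \<in> ?Q" for x using that by (simp add: \<phi>_def)
  have \<psi>Q: "\<psi> x \<in> ?Q'" if "x \<in> ?Q" for x using \<psi> that by (rule bij_betwE[THEN bspec])
  have "bij_betw \<phi> (v ` {..d}) (v' ` {..d})"
  proof (rule bij_betw_imageI)
    show "inj_on \<phi> (v ` {..d})" using inj(2) \<phi>v by (auto simp: inj_on_def)
    show "\<phi> ` v ` {..d} = v' ` {..d}" unfolding image_image by (rule image_cong) (auto simp: \<phi>v)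
  qed
  moreover have "bij_betw \<phi> ?Q ?Q'" using \<psi> bij_betw_cong[of ?Q \<phi> \<psi> ?Q'] \<phi>Q by blast
  ultimately have "bij_betw \<phi> (v ` {..d} \<union> ?Q) (v' ` {..d} \<union> ?Q')"
    by (rule bij_betw_combine) auto
  then have bij: "bij_betw \<phi> (pverts G) (pverts H)" using P by (simp add: Un_absorb1)
  have loop: "gdist H (\<phi> x) (\<phi> x) = gdist G x x" if "x \<in> pverts G" for x
  proof -
    have Hx: "\<phi> x \<in> pverts H" using bij that by (auto simp: bij_betw_def)
    have "gdist G x x = 0"
      unfolding gdist_def using G.awalk_Nil_iff[of x x] that by (intro Least_equality) auto
    moreover have "gdist H (\<phi> x) (\<phi> x) = 0"
      unfolding gdist_def using H.awalk_Nil_iff[of "\<phi> x" "\<phi> x"] Hx by (intro Least_equality) auto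
    ultimately show ?thesis by simp
  qed
  have VQ: "gdist H (\<phi> (v i)) (\<phi> u) = gdist G (v i) u" if "i \<le> d" "u \<in> ?Q" for i u
    using G(1) H(1) that \<phi>v[of i] \<phi>Q[of u] \<psi>Q[of u] by (auto simp: path_with_pendants_def)
  have VV: "gdist H (\<phi> (v i)) (\<phi> (v j)) = gdist G (v i) (v j)" if "i \<le> d" "j \<le> d" for i j
    using geo that \<phi>v by (auto simp: geodesic_def)
  have QQ: "gdist H (\<phi> u) (\<phi> w) = gdist G u w" if uw: "u \<in> ?Q" "w \<in> ?Q" for u w
  proof (cases "u = w")
    case False
    then have "\<psi> u \<noteq> \<psi> w" using \<psi> uw by (auto simp: bij_betw_def inj_on_def)
    then show ?thesis
      using G(1) H(1) False uw \<phi>Q \<psi>Q[of u] \<psi>Q[of w] by (auto simp: path_with_pendants_def)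
  qed (use loop uw in auto)
  have "gdist H (\<phi> x) (\<phi> y) = gdist G x y" if xy: "x \<in> pverts G" "y \<in> pverts G" for x y
  proof -
    have swap: "gdist H (\<phi> x) (\<phi> y) = gdist H (\<phi> y) (\<phi> x)" "gdist G x y = gdist G y x"
      by (rule gdist_commute, fact)+
    consider "x \<in> v ` {..d}" "y \<in> v ` {..d}" | "x \<in> v ` {..d}" "y \<in> ?Q"
      | "x \<in> ?Q" "y \<in> v ` {..d}" | "x \<in> ?Q" "y \<in> ?Q" using xy by blast
    then show ?thesis
    proof cases
      case 3
      then obtain j where "y = v j" "j \<le> d" by blast
      then show ?thesis using VQ[of j x] 3 swap by simp
    qed (use VV VQ QQ in auto)
  qed
  with bij show ?thesis by blast
qed

section \<open>Trees along a geodesic\<close>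

definition attached :: "'a pair_pre_digraph \<Rightarrow> (nat \<Rightarrow> 'a) \<Rightarrow> nat \<Rightarrow> 'a \<Rightarrow> bool" where
  "attached G v d u \<longleftrightarrow> (\<exists>i\<le>d. (u, v i) \<in> parcs G)"

context undirected_tree_graph
begin

text \<open>
  Start at the point \<open>v i\<close> of the geodesic that is nearest to \<open>r\<close>. Neither of the two walks
  along the geodesic from there begins by approaching \<open>r\<close>, so both recede from it forever.
\<close>

lemma geodesic_profile:
  assumes geo: "geodesic G v d" and r: "r \<in> pverts G"
  obtains i where "i \<le> d" "\<And>j. j \<le> d \<Longrightarrow> gdist G (v j) r = gdist G (v i) r + absdiff i j"
proof -
  have V: "v j \<in> pverts G" if "j \<le> d" for j using geo that by (simp add: geodesic_def)
  have D: "gdist G (v j) (v k) = absdiff j k" if "j \<le> d" "k \<le> d" for j k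
    using geo that by (simp add: geodesic_def)
  obtain i where "is_arg_min (\<lambda>j. gdist G (v j) r) (\<lambda>j. j \<in> {..d}) i"
    using ex_is_arg_min_if_finite[of "{..d}" "\<lambda>j. gdist G (v j) r"] by auto
  then have i: "i \<le> d" and min: "\<And>j. j \<le> d \<Longrightarrow> gdist G (v i) r \<le> gdist G (v j) r"
    by (simp_all add: is_arg_min_linorder)
  have neq: "v j \<noteq> v k" if "j \<le> d" "k \<le> d" "j \<noteq> k" for j k
    using geodesic_inj[OF geo] that by (auto simp: inj_on_eq_iff)
  have up: "gdist G (v (i + k)) r = gdist G (v i) r + k" if "k \<le> d - i" for k
    using gdist_grows_along_walk[OF r, of "d - i" "\<lambda>k. v (i + k)" k] that i min D V neq
    by (simp add: arc_iff_gdist_1)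
  have down: "gdist G (v (i - k)) r = gdist G (v i) r + k" if "k \<le> i" for k
    using gdist_grows_along_walk[OF r, of i "\<lambda>k. v (i - k)" k] that i min D V neq
    by (simp add: arc_iff_gdist_1)
  have "gdist G (v j) r = gdist G (v i) r + absdiff i j" if "j \<le> d" for j
    using up[of "j - i"] down[of "i - j"] that i by (cases "i \<le> j") auto
  with i show thesis using that by blast
qed

text \<open>
  Rooted at the end \<open>v 0\<close>, an attached vertex has its parent on the path. Otherwise it would be
  the parent of a path vertex \<open>v i\<close>, but that parent is \<open>v (i - 1)\<close>, or \<open>v i\<close> is the root.
\<close>

lemma off_path_neighbour_of_attached_farther:
  assumes geo: "geodesic G v d" and u: "u \<in> off_path G v d" "attached G v d u"
    and w: "w \<in> off_path G v d" "(u, w) \<in> parcs G"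
  shows "gdist G u (v 0) < gdist G w (v 0)"
proof (rule ccontr)
  assume "\<not> ?thesis"
  then have low: "gdist G w (v 0) \<le> gdist G u (v 0)" by simp
  have V: "v j \<in> pverts G" if "j \<le> d" for j using geo that by (simp add: geodesic_def)
  have D: "gdist G (v j) (v k) = absdiff j k" if "j \<le> d" "k \<le> d" for j k
    using geo that by (simp add: geodesic_def)
  obtain i where i: "i \<le> d" "(u, v i) \<in> parcs G" using u(2) by (auto simp: attached_def)
  have r: "v 0 \<in> pverts G" using V by simp
  have "w \<noteq> v i" using w i by blast
  then have "\<not> gdist G (v i) (v 0) \<le> gdist G u (v 0)"
    using nonfarther_neighbour_unique[OF r w(2) i(2) low] by blast
  then have up: "gdist G u (v 0) < i" using D[of i 0] i by simp
  then have i0: "0 < i" by simp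
  have "(v i, v (i - 1)) \<in> parcs G" using V D i i0 by (simp add: arc_iff_gdist_1)
  then have "u = v (i - 1)"
    using nonfarther_neighbour_unique[OF r arcs_symmetric[OF i(2)], of "v (i - 1)"] up D i by simp
  then show False using u(1) i by auto
qed

text \<open>
  Of the two ends of an arc outside the path, charge the one farther from \<open>v 0\<close>. No vertex is
  charged twice, since its neighbour towards \<open>v 0\<close> is unique, and no attached vertex is charged.
  The factor 2 comes from the two orientations of an edge.
\<close>

lemma card_arcs_off_path:
  assumes geo: "geodesic G v d"
  shows "card {(u, w). u \<in> off_path G v d \<and> w \<in> off_path G v d \<and> (u, w) \<in> parcs G}
    \<le> 2 * card {u \<in> off_path G v d. \<not> attached G v d u}"
proof -
  let ?Q = "off_path G v d" and ?N = "{u \<in> off_path G v d. \<not> attached G v d u}"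
  let ?A = "{(u, w). u \<in> ?Q \<and> w \<in> ?Q \<and> (u, w) \<in> parcs G}"
  define B where "B = {(u, w) \<in> ?A. gdist G w (v 0) \<le> gdist G u (v 0)}"
  have r: "v 0 \<in> pverts G" using geo by (simp add: geodesic_def)
  have finA: "finite ?A" by (rule finite_subset[OF _ pair_finite_arcs]) auto
  then have finB: "finite B" unfolding B_def by (rule rev_finite_subset) auto
  have "inj_on fst B"
    using nonfarther_neighbour_unique[OF r] by (force simp: B_def inj_on_def)
  moreover have "fst ` B \<subseteq> ?N"
    using off_path_neighbour_of_attached_farther[OF geo] by (force simp: B_def)
  ultimately have cB: "card B \<le> card ?N"
    using card_inj_on_le[of fst B ?N] pair_finite_verts by simp
  have "?A \<subseteq> B \<union> B\<inverse>" using arcs_symmetric by (auto simp: B_def)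
  then have "card ?A \<le> card (B \<union> B\<inverse>)" using finB by (intro card_mono) auto
  also have "\<dots> \<le> card B + card (B\<inverse>)" by (rule card_Un_le)
  finally show ?thesis using cB by simp
qed

lemma row_sum_attached:
  assumes geo: "geodesic G v d"
    and g: "strict_mono_on {0<..} g" and u: "u \<in> off_path G v d" "attached G v d u"
  shows "profile_sum g d 1 (d div 2) \<le> (\<Sum>j\<le>d. g (gdist G (v j) u))"
    and "(\<Sum>j\<le>d. g (gdist G (v j) u)) = profile_sum g d 1 (d div 2) \<Longrightarrow>
      \<exists>i\<in>{d div 2, d - d div 2}. \<forall>j\<le>d. gdist G (v j) u = Suc (absdiff i j)"
proof -
  have uV: "u \<in> pverts G" using u by simp
  obtain i where i: "i \<le> d" "\<And>j. j \<le> d \<Longrightarrow> gdist G (v j) u = gdist G (v i) u + absdiff i j"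
    using geodesic_profile[OF geo uV] by blast
  have V: "v j \<in> pverts G" if "j \<le> d" for j using geo that by (simp add: geodesic_def)
  obtain k where k: "k \<le> d" "(u, v k) \<in> parcs G" using u(2) by (auto simp: attached_def)
  have "gdist G (v k) u = 1"
    using k uV V arcs_symmetric arc_iff_gdist_1[of "v k" u] by blast
  moreover have "v i \<noteq> u" using u(1) i(1) by blast
  then have "gdist G (v i) u \<noteq> 0" using gdist_eq_0_iff[OF V[OF i(1)] uV] by blast
  ultimately have "gdist G (v i) u = 1" using i(2)[OF k(1)] by linarith
  then have dist: "gdist G (v j) u = Suc (absdiff i j)" if "j \<le> d" for j using i(2)[OF that] by simp
  then have R: "(\<Sum>j\<le>d. g (gdist G (v j) u)) = profile_sum g d 1 i"
    by (simp add: profile_sum_def)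
  show "profile_sum g d 1 (d div 2) \<le> (\<Sum>j\<le>d. g (gdist G (v j) u))"
    unfolding R using profile_sum_centre_le[OF g _ i(1)] by simp
  assume "(\<Sum>j\<le>d. g (gdist G (v j) u)) = profile_sum g d 1 (d div 2)"
  then have "i = d div 2 \<or> i = d - d div 2"
    using profile_sum_centre_less[OF g _ i(1), of 1] R by fastforce
  then show "\<exists>i\<in>{d div 2, d - d div 2}. \<forall>j\<le>d. gdist G (v j) u = Suc (absdiff i j)"
    using dist by blast
qed

lemma row_sum_not_attached:
  assumes geo: "geodesic G v d" "1 \<le> d"
    and g: "strict_mono_on {0<..} g" and u: "u \<in> off_path G v d" "\<not> attached G v d u"
  shows "profile_sum g d 1 (d div 2) + (g 2 - g 1) < (\<Sum>j\<le>d. g (gdist G (v j) u))"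
proof -
  have uV: "u \<in> pverts G" using u by simp
  obtain i where i: "i \<le> d" "\<And>j. j \<le> d \<Longrightarrow> gdist G (v j) u = gdist G (v i) u + absdiff i j"
    using geodesic_profile[OF geo(1) uV] by blast
  have V: "v i \<in> pverts G" using geo i by (simp add: geodesic_def)
  have "v i \<noteq> u" using u(1) i(1) by blast
  then have "gdist G (v i) u \<noteq> 0" using gdist_eq_0_iff[OF V uV] by blast
  moreover have "gdist G (v i) u \<noteq> 1"
  proof
    assume "gdist G (v i) u = 1"
    then have "(u, v i) \<in> parcs G" using V uV arc_iff_gdist_1[of u "v i"] dist_commute[of u] by simp
    then show False using u(2) i(1) by (auto simp: attached_def)
  qed
  ultimately have "2 \<le> gdist G (v i) u" by linarith
  then have "profile_sum g d 1 (d div 2) + (g 2 - g 1) < profile_sum g d (gdist G (v i) u) i"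
    using profile_sum_height_gain[OF g geo(2) _ i(1)] by blast
  also have "\<dots> = (\<Sum>j\<le>d. g (gdist G (v j) u))"
    unfolding profile_sum_def using i(2) by (intro sum.cong) auto
  finally show ?thesis .
qed

text \<open>
  Every vertex outside the path hangs at one of the at most two centres. If two of them hung at
  different centres, one would have distance 2 both to the other vertex and to the centre at which
  that vertex hangs, although these two are adjacent; an arc never joins two vertices at the same
  distance from a root. If all hang at the second centre, the path is reversed.
\<close>

lemma pendants_at_common_vertex:
  assumes geo: "geodesic G v d"
    and prof: "\<And>u. u \<in> off_path G v d \<Longrightarrow>
      \<exists>i\<in>{d div 2, d - d div 2}. \<forall>j\<le>d. gdist G (v j) u = Suc (absdiff i j)"
    and close: "\<And>u w. u \<in> off_path G v d \<Longrightarrow> w \<in> off_path G v d \<Longrightarrow> gdist G u w \<le> 2"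
  shows "\<exists>v'. path_with_pendants G v' d (d div 2)"
proof -
  let ?Q = "off_path G v d" and ?c = "d div 2"
  have V: "v j \<in> pverts G" if "j \<le> d" for j using geo that by (simp add: geodesic_def)
  have att: "attached G v d u" if uQ: "u \<in> ?Q" for u
  proof -
    obtain i where "i \<in> {?c, d - ?c}" "\<forall>j\<le>d. gdist G (v j) u = Suc (absdiff i j)"
      using prof[OF uQ] by blast
    then have "i \<le> d" "gdist G u (v i) = 1" using dist_commute[of u "v i"] by auto
    then show ?thesis using V arc_iff_gdist_1[of u "v i"] uQ by (auto simp: attached_def)
  qed
  have noarc: "(u, w) \<notin> parcs G" if "u \<in> ?Q" "w \<in> ?Q" for u w
    using off_path_neighbour_of_attached_farther[OF geo, of u w] off_path_neighbour_of_attached_farther[OF geo, of w u] att that arcs_symmetric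
    by fastforce
  have two: "gdist G u w = 2" if "u \<in> ?Q" "w \<in> ?Q" "u \<noteq> w" for u w
  proof -
    have "gdist G u w \<noteq> 1" "gdist G u w \<noteq> 0"
      using noarc[OF that(1,2)] arc_iff_gdist_1[of u w] that by auto
    then show ?thesis using close[OF that(1,2)] by linarith
  qed
  \<comment> \<open>With two centres, \<open>v i\<close> and \<open>u\<close> are adjacent and both at distance 2 from \<open>w\<close>.\<close>
  have same: "i = k"
    if u: "u \<in> ?Q" "i \<in> {?c, d - ?c}" "\<forall>j\<le>d. gdist G (v j) u = Suc (absdiff i j)"
      and w: "w \<in> ?Q" "k \<in> {?c, d - ?c}" "\<forall>j\<le>d. gdist G (v j) w = Suc (absdiff k j)" for u w i k
  proof (rule ccontr)
    assume ne: "i \<noteq> k"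
    have id: "i \<le> d" "k \<le> d" using u(2) w(2) by auto
    have ab: "absdiff k i = 1" using u(2) w(2) ne by auto
    have "u \<noteq> w" using u(3) w(3) id ne by auto
    then have "gdist G u w = 2" using two u w by blast
    moreover have "gdist G (v i) w = 2" using w(3) id ab by simp
    moreover have "gdist G (v i) u = 1" using u(3) id by simp
    then have "(v i, u) \<in> parcs G" using arc_iff_gdist_1[of "v i" u] V id u(1) by simp
    ultimately show False using gdist_arc_cases[of w "v i" u] w(1) by simp
  qed
  obtain c where c: "c \<in> {?c, d - ?c}" "\<And>u j. u \<in> ?Q \<Longrightarrow> j \<le> d \<Longrightarrow> gdist G (v j) u = Suc (absdiff c j)"
  proof (cases "?Q = {}")
    case False
    then obtain u where u: "u \<in> ?Q" by blast
    obtain i where i: "i \<in> {?c, d - ?c}" "\<forall>j\<le>d. gdist G (v j) u = Suc (absdiff i j)"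
      using prof[OF u] by blast
    have "gdist G (v j) w = Suc (absdiff i j)" if w: "w \<in> ?Q" "j \<le> d" for w j
    proof -
      obtain k where k: "k \<in> {?c, d - ?c}" "\<forall>j\<le>d. gdist G (v j) w = Suc (absdiff k j)"
        using prof[OF w(1)] by blast
      then show ?thesis using same[OF u i w(1) k] w(2) by simp
    qed
    then show thesis using that i(1) by blast
  qed (use that in blast)
  show ?thesis
  proof (cases "c = ?c")
    case True
    then have "path_with_pendants G v d ?c"
      unfolding path_with_pendants_def using geo c(2) two by blast
    then show ?thesis by blast
  next
    case False
    then have cd: "c = d - ?c" using c(1) by blast
    let ?v = "\<lambda>j. v (d - j)"
    have "?v ` {..d} = v ` {..d}"
    proof -
      have "bij_betw (\<lambda>j. d - j) {..d} {..d}"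
        by (rule bij_betw_byWitness[of _ "\<lambda>j. d - j"]) auto
      then have "(\<lambda>j. d - j) ` {..d} = {..d}" by (simp add: bij_betw_def)
      then show ?thesis by (metis image_image)
    qed
    moreover have "geodesic G ?v d"
      using geo by (auto simp: geodesic_def)
    moreover have "gdist G (?v j) u = Suc (absdiff ?c j)" if "u \<in> ?Q" "j \<le> d" for u j
      using c(2)[OF that(1), of "d - j"] cd that(2) by auto
    ultimately have "path_with_pendants G ?v d ?c"
      unfolding path_with_pendants_def using two by simp
    then show ?thesis by blast
  qed
qed

text \<open>
  The lower bounds \<open>rb\<close> for rows and \<open>hb\<close> for pairs outside the path hold term by term. An
  ordered adjacent pair outside the path falls short of \<open>g 2\<close> by \<open>g 2 - g 1\<close>, and this is paid
  by the surplus of the rows of vertices that are not attached. Equality of the totals forces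
  equality of all terms.
\<close>

lemma wiener_tree_bound:
  assumes geo: "geodesic G v d" "1 \<le> d" and g: "strict_mono_on {0<..} g"
  shows "pendant_path_value g d (card (off_path G v d)) \<le> 2 * wiener G g"
    and "2 * wiener G g = pendant_path_value g d (card (off_path G v d)) \<Longrightarrow>
      \<exists>v'. path_with_pendants G v' d (d div 2)"
proof -
  let ?Q = "off_path G v d" and ?S = "profile_sum g d 1 (d div 2)" and ?\<delta> = "g 2 - g 1"
  let ?A = "{(u, w). u \<in> ?Q \<and> w \<in> ?Q \<and> (u, w) \<in> parcs G}"
  let ?N = "{u \<in> ?Q. \<not> attached G v d u}"
  define R where "R u = (\<Sum>j\<le>d. g (gdist G (v j) u))" for u
  define H where "H u w = (if u = w then 0 else g (gdist G u w))" for u w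
  define rb where "rb u = ?S + (if attached G v d u then 0 else ?\<delta>)" for u
  define hb where "hb u w = (if u = w then 0 else g 2) - (if (u, w) \<in> parcs G then ?\<delta> else 0)" for u w
  have fin: "finite ?Q" using pair_finite_verts by simp
  have \<delta>: "0 < ?\<delta>" using strict_mono_onD[OF g, of 1 2] by simp
  have R: "rb u \<le> R u" if "u \<in> ?Q" for u
    using row_sum_attached(1)[OF geo(1) g that] row_sum_not_attached[OF geo g that]
    by (auto simp: rb_def R_def)
  have H: "hb u w \<le> H u w" "hb u w = H u w \<Longrightarrow> gdist G u w \<le> 2" if uw: "u \<in> ?Q" "w \<in> ?Q" for u w
  proof -
    have "hb u w = H u w \<and> gdist G u w \<le> 2 \<or> hb u w < H u w"
    proof (cases "u = w \<or> (u, w) \<in> parcs G")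
      case True
      then show ?thesis using uw arc_iff_gdist_1[of u w] no_loops' by (auto simp: hb_def H_def)
    next
      case False
      then have "gdist G u w \<noteq> 0" "gdist G u w \<noteq> 1" using arc_iff_gdist_1[of u w] uw by auto
      then have "gdist G u w = 2 \<or> g 2 < g (gdist G u w)"
        using strict_mono_onD[OF g, of 2 "gdist G u w"] by fastforce
      then show ?thesis using False by (auto simp: hb_def H_def)
    qed
    then show "hb u w \<le> H u w" "hb u w = H u w \<Longrightarrow> gdist G u w \<le> 2" by auto
  qed
  have srb: "(\<Sum>u\<in>?Q. rb u) = real (card ?Q) * ?S + real (card ?N) * ?\<delta>"
  proof -
    have "(\<Sum>u\<in>?Q. if attached G v d u then 0 else ?\<delta>) = (\<Sum>u\<in>?N. ?\<delta>)"
      using fin by (intro sum.mono_neutral_cong_right) auto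
    then show ?thesis by (simp add: rb_def sum.distrib)
  qed
  have shb: "(\<Sum>u\<in>?Q. \<Sum>w\<in>?Q. hb u w) =
      real (card ?Q) * (real (card ?Q) - 1) * g 2 - real (card ?A) * ?\<delta>"
  proof -
    have "(\<Sum>u\<in>?Q. \<Sum>w\<in>?Q. if (u, w) \<in> parcs G then ?\<delta> else 0)
        = (\<Sum>p\<in>?Q \<times> ?Q. if p \<in> parcs G then ?\<delta> else 0)"
      by (simp add: sum.cartesian_product split_def)
    also have "\<dots> = (\<Sum>p\<in>?A. ?\<delta>)"
      using fin by (intro sum.mono_neutral_cong_right) auto
    finally show ?thesis by (simp add: hb_def sum_subtractf sum_off_diagonal[OF fin])
  qed
  have "real (card ?A) * ?\<delta> \<le> real (2 * card ?N) * ?\<delta>"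
    using card_arcs_off_path[OF geo(1)] \<delta> by (intro mult_right_mono) (auto simp only: of_nat_le_iff)
  then have low: "pendant_path_value g d (card ?Q) \<le>
      (\<Sum>i\<le>d. \<Sum>j\<le>d. if i = j then 0 else g (absdiff i j)) +
      2 * (\<Sum>u\<in>?Q. rb u) + (\<Sum>u\<in>?Q. \<Sum>w\<in>?Q. hb u w)"
    unfolding pendant_path_value_def srb shb by (simp add: algebra_simps)
  have W: "2 * wiener G g = (\<Sum>i\<le>d. \<Sum>j\<le>d. if i = j then 0 else g (absdiff i j)) +
      2 * (\<Sum>u\<in>?Q. R u) + (\<Sum>u\<in>?Q. \<Sum>w\<in>?Q. H u w)"
    unfolding R_def H_def by (rule wiener_along_geodesic[OF geo(1)])
  have sR: "(\<Sum>u\<in>?Q. rb u) \<le> (\<Sum>u\<in>?Q. R u)" using R by (rule sum_mono)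
  have rowH: "(\<Sum>w\<in>?Q. hb u w) \<le> (\<Sum>w\<in>?Q. H u w)" if "u \<in> ?Q" for u
    using H(1)[OF that] by (rule sum_mono)
  then have sH: "(\<Sum>u\<in>?Q. \<Sum>w\<in>?Q. hb u w) \<le> (\<Sum>u\<in>?Q. \<Sum>w\<in>?Q. H u w)" by (rule sum_mono)
  show "pendant_path_value g d (card ?Q) \<le> 2 * wiener G g" using low W sR sH by linarith
  assume eq: "2 * wiener G g = pendant_path_value g d (card ?Q)"
  then have eR: "(\<Sum>u\<in>?Q. rb u) = (\<Sum>u\<in>?Q. R u)"
    and eH: "(\<Sum>u\<in>?Q. \<Sum>w\<in>?Q. hb u w) = (\<Sum>u\<in>?Q. \<Sum>w\<in>?Q. H u w)"
    using low W sR sH by linarith+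
  have rows: "rb u = R u" if "u \<in> ?Q" for u using sum_mono_inv[OF eR R that fin] .
  have prof: "\<exists>i\<in>{d div 2, d - d div 2}. \<forall>j\<le>d. gdist G (v j) u = Suc (absdiff i j)"
    if u: "u \<in> ?Q" for u
  proof (cases "attached G v d u")
    case True
    then have "R u = ?S" using rows[OF u] by (simp add: rb_def)
    then show ?thesis unfolding R_def by (rule row_sum_attached(2)[OF geo(1) g u True])
  next
    case False
    then have "R u = ?S + ?\<delta>" using rows[OF u] by (simp add: rb_def)
    then show ?thesis using row_sum_not_attached[OF geo g u False] unfolding R_def by simp
  qed
  have rowHs: "(\<Sum>w\<in>?Q. hb u w) = (\<Sum>w\<in>?Q. H u w)" if "u \<in> ?Q" for u
    using sum_mono_inv[OF eH rowH that fin] .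
  have "hb u w = H u w" if u: "u \<in> ?Q" and w: "w \<in> ?Q" for u w
  proof -
    have "hb u x \<le> H u x" if "x \<in> ?Q" for x using H(1)[OF u that] .
    then show ?thesis using sum_mono_inv[OF rowHs[OF u] _ w fin] by blast
  qed
  then have "gdist G u w \<le> 2" if "u \<in> ?Q" "w \<in> ?Q" for u w using H(2) that by blast
  with prof show "\<exists>v'. path_with_pendants G v' d (d div 2)"
    by (rule pendants_at_common_vertex[OF geo(1)])
qed

end

section \<open>The extremal tree\<close>

definition star_path_dist :: "nat \<Rightarrow> nat \<Rightarrow> nat \<Rightarrow> nat" where
  "star_path_dist d x y =
     (if x = y then 0
      else if x \<le> d \<and> y \<le> d then absdiff x y
      else if x \<le> d then Suc (absdiff (d div 2) x)
      else if y \<le> d then Suc (absdiff (d div 2) y)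
      else 2)"

lemma arc_centre_star_path:
  "(x, y) \<in> parcs (centre_star_path d n) \<longleftrightarrow>
     (x < d \<and> y = Suc x) \<or> (y < d \<and> x = Suc y) \<or>
     (x = d div 2 \<and> d < y \<and> y < n) \<or> (y = d div 2 \<and> d < x \<and> x < n)"
  by (auto simp: centre_star_path_def symcl_def)

lemma
  assumes "d < n" "r < n"
  shows gdist_centre_star_path: "u < n \<Longrightarrow> gdist (centre_star_path d n) u r = star_path_dist d u r"
    and centre_star_path_walk: "u < n \<Longrightarrow> \<exists>p. pre_digraph.awalk (with_proj (centre_star_path d n)) u p r"
proof -
  let ?G = "centre_star_path d n"
  interpret pair_graph ?G using assms(1) by (rule pair_graph_centre_star_path)
  have V: "pverts ?G = {..<n}" by (simp add: centre_star_path_def)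
  let ?D = "\<lambda>u. star_path_dist d u r"
  have closer: "\<exists>w. (u, w) \<in> parcs ?G \<and> ?D u = Suc (?D w)" if u: "u < n" "u \<noteq> r" for u
  proof (cases "u \<le> d")
    case False
    then show ?thesis using u assms
      by (intro exI[of _ "d div 2"]) (auto simp: arc_centre_star_path star_path_dist_def)
  next
    case True
    \<comment> \<open>The point of the path towards which the way to \<open>r\<close> leads.\<close>
    define t where "t = (if r \<le> d then r else d div 2)"
    consider "u < t" | "t < u" | "u = t" by linarith
    then show ?thesis
    proof cases
      case 1
      then show ?thesis using u assms True
        by (intro exI[of _ "Suc u"]) (auto simp: arc_centre_star_path star_path_dist_def t_def split: if_splits)
    next
      case 2
      then show ?thesis using u assms True
        by (intro exI[of _ "u - 1"]) (auto simp: arc_centre_star_path star_path_dist_def t_def split: if_splits)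
    next
      case 3
      then show ?thesis using u assms True
        by (intro exI[of _ r]) (auto simp: arc_centre_star_path star_path_dist_def t_def split: if_splits)
    qed
  qed
  have arc: "?D u \<le> Suc (?D w)" if "(u, w) \<in> parcs ?G" for u w
    using that assms by (auto simp: arc_centre_star_path star_path_dist_def)
  show "gdist ?G u r = ?D u" "\<exists>p. awalk u p r" if "u < n"
    using gdist_eqI[of ?D r u] closer arc assms that by (auto simp: V star_path_dist_def)
qed

lemma connected_centre_star_path:
  assumes "d < n"
  shows "connected_pair_graph (centre_star_path d n)"
proof -
  interpret pair_graph "centre_star_path d n" using assms by (rule pair_graph_centre_star_path)
  show ?thesis
    by unfold_locales (use centre_star_path_walk[OF assms] in \<open>auto simp: centre_star_path_def\<close>)
qed

lemma path_with_pendants_centre_star_path: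
  assumes "d < n"
  shows "path_with_pendants (centre_star_path d n) id d (d div 2)"
proof -
  have V: "pverts (centre_star_path d n) = {..<n}" by (simp add: centre_star_path_def)
  show ?thesis
    unfolding path_with_pendants_def geodesic_def V
    using assms by (auto simp: gdist_centre_star_path star_path_dist_def)
qed

section \<open>Comparison with the extremal tree\<close>

lemma wiener_uminus: "wiener G (\<lambda>k. - g k) = - wiener G g"
  by (simp add: wiener_def sum_negf)

lemma wiener_minimal_increasing:
  assumes d: "2 \<le> d" "d \<le> n - 1"
    and T: "undirected_tree T" "card (pverts T) = n" "gdiameter T = d"
    and g: "strict_mono_on {0<..} g"
  shows "wiener (centre_star_path d n) g \<le> wiener T g \<and>
    (wiener T g = wiener (centre_star_path d n) g \<longleftrightarrow>
      digraph_iso (with_proj T) (with_proj (centre_star_path d n)))"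
proof -
  let ?S = "centre_star_path d n"
  interpret T: undirected_tree_graph T using T(1) by (rule undirected_tree_graphI)
  have dn: "d < n" using d by simp
  interpret S: connected_pair_graph ?S using dn by (rule connected_centre_star_path)
  let ?D = "{gdist T u v | u v. u \<in> pverts T \<and> v \<in> pverts T}"
  have "?D = (\<lambda>(u, v). gdist T u v) ` (pverts T \<times> pverts T)" by auto
  then have "finite ?D" using T.pair_finite_verts by simp
  moreover have "pverts T \<noteq> {}" using T(2) dn by auto
  then have "?D \<noteq> {}" by blast
  ultimately have "d \<in> ?D" using T(3) Max_in unfolding gdiameter_def by blast
  then obtain x y where xy: "x \<in> pverts T" "y \<in> pverts T" "gdist T x y = d" by blast
  obtain v where geo: "geodesic T v d"
    using T.obtain_geodesic[OF xy(1,2)] unfolding xy(3) geodesic_def by metis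
  have pS: "path_with_pendants ?S id d (d div 2)"
    using dn by (rule path_with_pendants_centre_star_path)
  then have geoS: "geodesic ?S id d" by (simp add: path_with_pendants_def)
  have VS: "card (pverts ?S) = n" by (simp add: centre_star_path_def)
  have "card (off_path T v d) = card (off_path ?S id d)"
    using card_off_path[OF geo] card_off_path[OF geoS] T.pair_finite_verts S.pair_finite_verts T(2) VS
    by simp
  then have WS: "2 * wiener ?S g = pendant_path_value g d (card (off_path T v d))"
    using S.wiener_path_with_pendants[OF pS] by simp
  have d1: "1 \<le> d" using d by simp
  note bound = T.wiener_tree_bound[OF geo d1 g]
  have "digraph_iso (with_proj T) (with_proj ?S)" if eq: "wiener T g = wiener ?S g"
  proof -
    have "2 * wiener T g = pendant_path_value g d (card (off_path T v d))" using eq WS by simp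
    then obtain v' where "path_with_pendants T v' d (d div 2)" using bound(2) by blast
    then obtain \<phi> where "bij_betw \<phi> (pverts T) (pverts ?S)"
      "\<forall>x\<in>pverts T. \<forall>y\<in>pverts T. gdist ?S (\<phi> x) (\<phi> y) = gdist T x y"
      using path_with_pendants_isometry[OF _ T.pair_graph_axioms pS S.pair_graph_axioms] T(2) VS
      by metis
    then show ?thesis
      by (intro isometry_imp_digraph_iso[OF T.connected_pair_graph_axioms S.connected_pair_graph_axioms])
        auto
  qed
  moreover have "wiener T g = wiener ?S g" if "digraph_iso (with_proj T) (with_proj ?S)"
    using digraph_iso_imp_isometry[OF T.pair_wf_digraph that]
      wiener_isometry[OF T.pair_graph_axioms S.pair_graph_axioms] by metis
  ultimately show ?thesis using bound(1) WS by auto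
qed

theorem theorem4:
  fixes g :: "nat \<Rightarrow> real" and n d :: nat and T :: "'a pair_pre_digraph"
  assumes "\<And>k. 0 < k \<Longrightarrow> 0 \<le> g k"
    and "2 \<le> d" and "d \<le> n - 1"
    and "undirected_tree T"
    and "card (pverts T) = n"
    and "gdiameter T = d"
  shows "(strict_mono_on {0<..} g \<longrightarrow>
            wiener T g \<ge> wiener (centre_star_path d n) g \<and>
            (wiener T g = wiener (centre_star_path d n) g \<longleftrightarrow>
               digraph_iso (with_proj T) (with_proj (centre_star_path d n)))) \<and>
         (strict_antimono_on {0<..} g \<longrightarrow>
            wiener T g \<le> wiener (centre_star_path d n) g \<and>
            (wiener T g = wiener (centre_star_path d n) g \<longleftrightarrow>
               digraph_iso (with_proj T) (with_proj (centre_star_path d n))))"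
proof (intro conjI impI; (elim conjE)?)
  note min = wiener_minimal_increasing[OF assms(2-6)]
  {
    assume "strict_mono_on {0<..} g"
    from min[OF this]
    show "wiener T g \<ge> wiener (centre_star_path d n) g"
      "wiener T g = wiener (centre_star_path d n) g \<longleftrightarrow>
        digraph_iso (with_proj T) (with_proj (centre_star_path d n))" by blast+
  next
    assume "strict_antimono_on {0<..} g"
    then have "strict_mono_on {0<..} (\<lambda>k. - g k)" by (auto simp: monotone_on_def)
    from min[OF this]
    show "wiener T g \<le> wiener (centre_star_path d n) g"
      "wiener T g = wiener (centre_star_path d n) g \<longleftrightarrow>
        digraph_iso (with_proj T) (with_proj (centre_star_path d n))"
      by (simp_all add: wiener_uminus)
  }
qed

end
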